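(* Let $k, d$ be positive integers. Every continuous $(\mathbb{Z}_2)^{k+1}$-equivariant map \[ f : S^d \times V_k(\mathbb{R}^d) \to \mathbb{R}^d \times \mathbb{R}^{d-1} \times \cdots \times \mathbb{R}^{d-k} \] has a zero.
   Context: $V_k(\mathbb{R}^d) = \{(v_1,\ldots,v_k) : v_1,\ldots,v_k \in \mathbb{R}^d \text{ orthonormal}\}$ is the Stiefel manifold of orthonormal $k$-frames, and $S^d$ is the unit sphere in $\mathbb{R}^{d+1}$. Write $\mathbb{Z}_2 = \{+1,-1\}$ under multiplication. The group $(\mathbb{Z}_2)^{k+1}$ acts on $S^d \times V_k(\mathbb{R}^d)$ by $(\lambda_0,\lambda_1,\ldots,\lambda_k)\cdot(v, v_1,\ldots,v_k) = (\lambda_0 v, \lambda_1 v_1, \ldots, \lambda_k v_k)$, and on $\mathbb{R}^d \times \mathbb{R}^{d-1}\times\cdots\times\mathbb{R}^{d-k}$ by $(\lambda_0,\ldots,\lambda_k)\cdot(x_0, x_1,\ldots,x_k) = (\lambda_0 x_0, \lambda_1 x_1, \ldots, \lambda_k x_k)$ with $x_i \in \mathbb{R}^{d-i}$. A map is equivariant if it commutes with these actions. *)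

theory Defs
  imports "HOL-Analysis.Analysis"
begin

text \<open>
  Points of real \<open>n\<close>-space are sequences \<open>nat \<Rightarrow> real\<close> vanishing from index \<open>n\<close> on, as in
  \<^const>\<open>Euclidean_space\<close>; \<open>S\<^sup>d\<close> is the library's \<^const>\<open>nsphere\<close>, a subspace of
  \<open>Euclidean_space (Suc d)\<close>.  Tuples of vectors indexed by \<open>I\<close> are extensional functions on \<open>I\<close>,
  the points of a \<^const>\<open>product_topology\<close>.
\<close>

definition Stiefel :: "nat \<Rightarrow> nat \<Rightarrow> (nat \<Rightarrow> nat \<Rightarrow> real) topology"
  where "Stiefel k d =
    subtopology (product_topology (\<lambda>i. Euclidean_space d) {1..k})
      {v. \<forall>i\<in>{1..k}. \<forall>j\<in>{1..k}. (\<Sum>m<d. v i m * v j m) = (if i = j then 1 else 0)}"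

definition sphere_Stiefel :: "nat \<Rightarrow> nat \<Rightarrow> ((nat \<Rightarrow> real) \<times> (nat \<Rightarrow> nat \<Rightarrow> real)) topology"
  where "sphere_Stiefel k d = prod_topology (nsphere d) (Stiefel k d)"

text \<open>For \<open>k \<le> d\<close> the subtraction below is not truncated; for \<open>k = d\<close> the last factor is a point.\<close>

definition target_space :: "nat \<Rightarrow> nat \<Rightarrow> (nat \<Rightarrow> nat \<Rightarrow> real) topology"
  where "target_space k d = product_topology (\<lambda>i. Euclidean_space (d - i)) {0..k}"

definition sign_group :: "nat \<Rightarrow> (nat \<Rightarrow> real) set"
  where "sign_group k = {0..k} \<rightarrow>\<^sub>E {1, -1}"

definition scale_tuple :: "nat set \<Rightarrow> (nat \<Rightarrow> real) \<Rightarrow> (nat \<Rightarrow> nat \<Rightarrow> real) \<Rightarrow> (nat \<Rightarrow> nat \<Rightarrow> real)"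
  where "scale_tuple I l x = (\<lambda>i\<in>I. \<lambda>m. l i * x i m)"

definition source_action ::
    "nat \<Rightarrow> (nat \<Rightarrow> real) \<Rightarrow> (nat \<Rightarrow> real) \<times> (nat \<Rightarrow> nat \<Rightarrow> real)
       \<Rightarrow> (nat \<Rightarrow> real) \<times> (nat \<Rightarrow> nat \<Rightarrow> real)"
  where "source_action k l p = ((\<lambda>m. l 0 * fst p m), scale_tuple {1..k} l (snd p))"

definition target_action :: "nat \<Rightarrow> (nat \<Rightarrow> real) \<Rightarrow> (nat \<Rightarrow> nat \<Rightarrow> real) \<Rightarrow> (nat \<Rightarrow> nat \<Rightarrow> real)"
  where "target_action k l x = scale_tuple {0..k} l x"

definition sign_equivariant ::
    "nat \<Rightarrow> nat \<Rightarrow> ((nat \<Rightarrow> real) \<times> (nat \<Rightarrow> nat \<Rightarrow> real) \<Rightarrow> (nat \<Rightarrow> nat \<Rightarrow> real)) \<Rightarrow> bool"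
  where "sign_equivariant k d f \<longleftrightarrow>
    (\<forall>l\<in>sign_group k. \<forall>p\<in>topspace (sphere_Stiefel k d).
       f (source_action k l p) = target_action k l (f p))"

end

theory Submission
  imports Defs "HOL-Library.Z2"
begin

text \<open>
  Extend the components of \<open>f\<close> equivariantly to all tuples of vectors and add the components
  \<open>\<langle>v\<^sub>i, v\<^sub>j\<rangle>\<close>, \<open>1 \<le> i < j \<le> k\<close>: their common zeros on \<open>S\<^sup>d \<times> (S\<^sup>d\<^sup>-\<^sup>1)\<^sup>k\<close> are the zeros of \<open>f\<close>, and
  there are as many components as dimensions. Each component changes sign according to a character
  \<open>t\<^sub>i\<close> or \<open>t\<^sub>i + t\<^sub>j\<close>, so its sign on the vertices of a triangulation is a \<open>0\<close>-cochain \<open>s\<close> whose coboundary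
  is a mod \<open>2\<close> cocycle on the quotient by the group. The cup product of these cocycles, summed over
  all simplices, depends only on the characters; for a suitable choice of the cochains exactly one
  simplex contributes, so the sum is \<open>1\<close>. Hence on every triangulation some simplex has a sign change
  of every component, along an edge of its own, and a limit of ever smaller such simplices is a
  common zero.
\<close>

section \<open>Cup products of coboundaries mod 2\<close>

lemma bit_add_self: "x + x = (0::bit)"
  by (cases x) auto

lemma bit_add_eq_0_iff: "x + y = (0::bit) \<longleftrightarrow> x = y"
  by (cases x; cases y) auto

text \<open>The orbits of \<open>\<tau>\<close> are pairs with equal values, which cancel in
  characteristic 2.\<close>

lemma sum_bit_involution:
  fixes f :: "'a \<Rightarrow> bit"
  assumes "finite S"
    and "\<And>x. x \<in> S \<Longrightarrow> \<tau> x \<in> S" and "\<And>x. x \<in> S \<Longrightarrow> \<tau> (\<tau> x) = x"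
    and "\<And>x. x \<in> S \<Longrightarrow> \<tau> x \<noteq> x" and "\<And>x. x \<in> S \<Longrightarrow> f (\<tau> x) = f x"
  shows "(\<Sum>x\<in>S. f x) = 0"
  using assms
proof (induction "card S" arbitrary: S rule: less_induct)
  case less
  show ?case
  proof (cases "S = {}")
    case False
    then obtain x where x: "x \<in> S" by auto
    define T where "T = S - {x, \<tau> x}"
    have T: "T \<subset> S" using x by (auto simp: T_def)
    have inv: "\<tau> y \<in> T" if "y \<in> T" for y
    proof -
      have y: "y \<in> S" "y \<noteq> x" "y \<noteq> \<tau> x" using that by (auto simp: T_def)
      then show ?thesis
        using less.prems(2,3) x unfolding T_def by (metis Diff_iff insertE singletonD)
    qed
    have "(\<Sum>y\<in>T. f y) = 0"
      by (rule less.hyps[OF psubset_card_mono[OF less.prems(1) T]])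
        (use T less.prems inv in \<open>auto intro: finite_subset\<close>)
    moreover have "S = insert x (insert (\<tau> x) T)" "x \<notin> insert (\<tau> x) T" "\<tau> x \<notin> T" "finite T"
      using x less.prems(1,2) less.prems(4)[OF x] by (auto simp: T_def)
    ultimately show ?thesis
      using less.prems(5)[OF x] by (simp add: bit_add_self flip: add.assoc)
  qed simp
qed

text \<open>The coface map: \<open>v \<circ> skip j\<close> is the facet of the ordered simplex
  \<open>v\<close> opposite to its \<open>j\<close>-th vertex.\<close>

definition skip :: "nat \<Rightarrow> nat \<Rightarrow> nat"
  where "skip j t = (if t < j then t else Suc t)"

text \<open>The value of the cup product of the cocycles \<open>\<delta>s\<^sub>0, \<dots>, \<delta>s\<^bsub>n-1\<^esub>\<close> on the ordered simplex \<open>v\<close>.\<close>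

definition jumps :: "nat \<Rightarrow> (nat \<Rightarrow> 'v \<Rightarrow> bit) \<Rightarrow> (nat \<Rightarrow> 'v) \<Rightarrow> bit"
  where "jumps n s v = (\<Prod>t<n. s t (v t) + s t (v (Suc t)))"

lemma jumps_cong:
  "(\<And>t. t < n \<Longrightarrow> s t = s' t) \<Longrightarrow> (\<And>t. t \<le> n \<Longrightarrow> v t = v' t) \<Longrightarrow> jumps n s v = jumps n s' v'"
  unfolding jumps_def by (intro prod.cong) auto

text \<open>A cup product of cocycles is a cocycle. The last factor is the same on all facets
  \<open>j \<le> n\<close>, and the induction hypothesis turns the sum of the others over these
  facets into the one facet missing from it.\<close>

lemma jumps_coboundary: "(\<Sum>j\<le>Suc n. jumps n s (v \<circ> skip j)) = 0"
proof (induction n)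
  case 0
  show ?case by (simp add: jumps_def bit_add_self)
next
  case (Suc n)
  let ?P = "\<lambda>j. jumps n s (v \<circ> skip j)"
  have low: "jumps (Suc n) s (v \<circ> skip j) = ?P j * (s n (v (Suc n)) + s n (v (Suc (Suc n))))" if "j \<le> n" for j
    using that by (simp add: jumps_def skip_def)
  have a: "jumps (Suc n) s (v \<circ> skip (Suc n)) = ?P (Suc n) * (s n (v n) + s n (v (Suc (Suc n))))"
    by (simp add: jumps_def skip_def)
  have "jumps n s (v \<circ> skip (Suc (Suc n))) = ?P (Suc n)"
    by (rule jumps_cong) (auto simp: skip_def)
  then have b: "jumps (Suc n) s (v \<circ> skip (Suc (Suc n))) = ?P (Suc n) * (s n (v n) + s n (v (Suc n)))"
    by (simp add: jumps_def skip_def)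
  have S: "(\<Sum>j\<le>n. ?P j) = ?P (Suc n)"
    using Suc.IH by (simp only: sum.atMost_Suc bit_add_eq_0_iff)
  have "(\<Sum>j\<le>n. jumps (Suc n) s (v \<circ> skip j)) = (\<Sum>j\<le>n. ?P j) * (s n (v (Suc n)) + s n (v (Suc (Suc n))))"
    unfolding sum_distrib_right by (intro sum.cong refl low) simp
  then show ?case
    unfolding sum.atMost_Suc a b S
    by (cases "?P (Suc n)"; cases "s n (v n)"; cases "s n (v (Suc n))"; cases "s n (v (Suc (Suc n)))") auto
qed

text \<open>The cup product of the cocycles \<open>\<delta>s\<^sub>t\<close>, \<open>t < i\<close>, the \<open>0\<close>-cochain \<open>u\<close>,
  and the cocycles \<open>\<delta>s\<^sub>t\<close>, \<open>i < t \<le> i + n\<close>.\<close>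

definition cup_mid :: "nat \<Rightarrow> nat \<Rightarrow> (nat \<Rightarrow> 'v \<Rightarrow> bit) \<Rightarrow> ('v \<Rightarrow> bit) \<Rightarrow> (nat \<Rightarrow> 'v) \<Rightarrow> bit"
  where "cup_mid i n s u F =
    jumps i s F * u (F i) * jumps n (\<lambda>t. s (Suc (i + t))) (\<lambda>t. F (i + t))"

text \<open>Leibniz rule: all factors but \<open>u\<close> are cocycles, so the coboundary falls on
  \<open>u\<close> alone.\<close>

lemma cup_mid_coboundary:
  "(\<Sum>j\<le>Suc (i + n). cup_mid i n s u (v \<circ> skip j)) = jumps (Suc (i + n)) (s(i := u)) v"
proof -
  let ?A = "jumps i s v" and ?s = "\<lambda>t. s (Suc (i + t))" and ?v = "\<lambda>t. v (i + t)"
  let ?B = "jumps n ?s (\<lambda>t. v (Suc (i + t)))"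
  have low: "cup_mid i n s u (v \<circ> skip j) = jumps i s (v \<circ> skip j) * (u (v (Suc i)) * ?B)" if "j \<le> i" for j
    using that by (simp add: cup_mid_def skip_def jumps_def)
  have high: "cup_mid i n s u (v \<circ> skip (Suc (i + t))) = ?A * u (v i) * jumps n ?s (?v \<circ> skip (Suc t))" for t
  proof -
    have "jumps i s (v \<circ> skip (Suc (i + t))) = ?A"
      by (rule jumps_cong) (auto simp: skip_def)
    moreover have "jumps n ?s (\<lambda>t'. (v \<circ> skip (Suc (i + t))) (i + t')) = jumps n ?s (?v \<circ> skip (Suc t))"
      by (rule jumps_cong) (auto simp: skip_def)
    ultimately show ?thesis by (simp add: cup_mid_def skip_def)
  qed
  have "jumps i s (v \<circ> skip (Suc i)) = ?A"
    by (rule jumps_cong) (auto simp: skip_def)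
  with jumps_coboundary[of i s v] have 1: "(\<Sum>j\<le>i. jumps i s (v \<circ> skip j)) = ?A"
    by (simp only: sum.atMost_Suc bit_add_eq_0_iff)
  have "jumps n ?s (?v \<circ> skip 0) = ?B"
    by (rule jumps_cong) (auto simp: skip_def)
  with jumps_coboundary[of n ?s ?v] have 2: "(\<Sum>t\<le>n. jumps n ?s (?v \<circ> skip (Suc t))) = ?B"
    by (simp only: sum.atMost_Suc_shift bit_add_eq_0_iff)
  have split: "(\<Sum>j\<le>Suc (i + n). h j) = (\<Sum>j\<le>i. h j) + (\<Sum>t\<le>n. h (Suc (i + t)))" for h :: "nat \<Rightarrow> bit"
    by (induction n) (auto simp: add.assoc)
  have "(\<Sum>j\<le>Suc (i + n). cup_mid i n s u (v \<circ> skip j)) = ?A * (u (v i) + u (v (Suc i))) * ?B"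
  proof -
    have "(\<Sum>j\<le>i. cup_mid i n s u (v \<circ> skip j)) = ?A * (u (v (Suc i)) * ?B)"
      unfolding 1[symmetric] sum_distrib_right by (intro sum.cong refl low) simp
    moreover have "(\<Sum>t\<le>n. cup_mid i n s u (v \<circ> skip (Suc (i + t)))) = ?A * u (v i) * ?B"
      unfolding 2[symmetric] sum_distrib_left by (intro sum.cong refl high)
    ultimately show ?thesis
      unfolding split by (simp only: distrib_left distrib_right mult.assoc add.commute)
  qed
  also have "\<dots> = jumps (Suc (i + n)) (s(i := u)) v"
  proof -
    let ?f = "\<lambda>t. (s(i := u)) t (v t) + (s(i := u)) t (v (Suc t))"
    have psplit: "(\<Prod>t<Suc (i + n). h t) = (\<Prod>t<i. h t) * h i * (\<Prod>t<n. h (Suc (i + t)))" for h :: "nat \<Rightarrow> bit"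
      by (induction n) (auto simp: mult.assoc)
    show ?thesis unfolding jumps_def psplit by simp
  qed
  finally show ?thesis .
qed

lemma jumps_eq_1_iff: "jumps n s v = 1 \<longleftrightarrow> (\<forall>t<n. s t (v t) \<noteq> s t (v (Suc t)))"
proof -
  have "a + b = 1 \<longleftrightarrow> a \<noteq> b" for a b :: bit by (cases a; cases b) auto
  then show ?thesis
    unfolding jumps_def by (induction n) (auto simp: less_Suc_eq)
qed

section \<open>The cubical grid\<close>

text \<open>The coordinates \<open>c\<close> with \<open>blk c = b\<close> parametrise a hemisphere of the \<open>b\<close>-th sphere by a cube;
  the antipodal map of that sphere acts on the boundary of this cube as \<open>flip blk b\<close>.\<close>

definition flip :: "('c \<Rightarrow> nat) \<Rightarrow> nat \<Rightarrow> ('c \<Rightarrow> 'a) \<Rightarrow> 'c \<Rightarrow> 'a::uminus"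
  where "flip blk b x = (\<lambda>c. if blk c = b then - x c else x c)"

text \<open>Generic in the scalars, to serve both the integer grid with bound \<open>m\<close> and
  the real cube with bound \<open>1\<close>.\<close>

definition on_rim :: "'c set \<Rightarrow> ('c \<Rightarrow> nat) \<Rightarrow> 'a \<Rightarrow> nat \<Rightarrow> ('c \<Rightarrow> 'a::linordered_idom) \<Rightarrow> bool"
  where "on_rim I blk m b x \<longleftrightarrow> (\<forall>c\<in>I. \<bar>x c\<bar> \<le> m) \<and> (\<exists>c\<in>I. blk c = b \<and> \<bar>x c\<bar> = m)"

locale cube_grid =
  fixes I :: "'c set" and blk :: "'c \<Rightarrow> nat" and m :: int
  assumes finite_I: "finite I" and m_gt_1: "1 < m"
begin

text \<open>The triple \<open>(k, e, p)\<close> is the simplex that starts at the vertex \<open>e \<cdot> k\<close> of the grid \<open>[-m, m]\<^sup>I\<close>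
  and moves one step away from \<open>0\<close> in each coordinate, in the order \<open>p\<close>. Orienting the edges
  away from \<open>0\<close> makes the orientation invariant under sign changes.\<close>

definition simplices :: "(('c \<Rightarrow> int) \<times> ('c \<Rightarrow> int) \<times> 'c list) set"
  where "simplices = (I \<rightarrow>\<^sub>E {0..<m}) \<times> (I \<rightarrow>\<^sub>E {1, -1}) \<times> {p. distinct p \<and> set p = I}"

fun vert :: "('c \<Rightarrow> int) \<times> ('c \<Rightarrow> int) \<times> 'c list \<Rightarrow> nat \<Rightarrow> 'c \<Rightarrow> int"
  where "vert (k, e, p) j = (\<lambda>c. if c \<in> I then e c * (k c + of_bool (c \<in> set (take j p))) else 0)"

text \<open>\<open>mate (\<sigma>, j)\<close> is the other simplex that contains the facet of \<open>\<sigma>\<close> opposite to its \<open>j\<close>-th vertex,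
  up to the identification of antipodal rim points, with the index of its own vertex opposite to it.\<close>

fun mate where
  "mate ((k, e, p), j) =
    (if j = length p then
       if 0 < k (last p) then ((k(last p := k (last p) - 1), e, last p # butlast p), 0)
       else ((k, e(last p := - e (last p)), p), j)
     else if j = 0 then
       if k (hd p) + 1 < m then ((k(hd p := k (hd p) + 1), e, tl p @ [hd p]), length p)
       else ((k, restrict (flip blk (blk (hd p)) e) I, p), 0)
     else ((k, e, p[j - 1 := p ! j, j := p ! (j - 1)]), j))"

declare vert.simps [simp del] mate.simps [simp del]

lemma finite_simplices: "finite simplices"
proof -
  have "{p. distinct p \<and> set p = I} \<subseteq> {p. set p \<subseteq> I \<and> length p \<le> card I}"
    by (auto dest: distinct_card)
  then have "finite {p. distinct p \<and> set p = I}"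
    using finite_lists_length_le[OF finite_I] finite_subset by blast
  then show ?thesis
    unfolding simplices_def using finite_I by (intro finite_cartesian_product finite_PiE) auto
qed

text \<open>The facet opposite to the last vertex lies in a hyperplane; the simplex behind it starts
  one unit closer to \<open>0\<close>, or is the mirror image if the hyperplane contains
  \<open>0\<close>. Opposite to the first vertex one moves outwards, or to the antipode on the rim.
  Opposite to a middle vertex two consecutive steps are exchanged.\<close>

lemma mate:
  assumes "\<sigma> \<in> simplices" and "j \<le> card I" and "I \<noteq> {}" and eq: "mate (\<sigma>, j) = (\<sigma>', j')"
  shows "\<sigma>' \<in> simplices \<and> j' \<le> card I \<and> mate (\<sigma>', j') = (\<sigma>, j) \<and> (\<sigma>', j') \<noteq> (\<sigma>, j) \<and>
    ((\<forall>t<card I. vert \<sigma>' (skip j' t) = vert \<sigma> (skip j t)) \<or>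
     (\<exists>b. \<forall>t<card I. on_rim I blk m b (vert \<sigma> (skip j t)) \<and>
        vert \<sigma>' (skip j' t) = flip blk b (vert \<sigma> (skip j t))))"
proof -
  obtain k e p where \<sigma>: "\<sigma> = (k, e, p)" by (cases \<sigma>)
  from assms(1) have k: "k \<in> I \<rightarrow>\<^sub>E {0..<m}" and e: "e \<in> I \<rightarrow>\<^sub>E {1, -1}"
    and p: "distinct p" "set p = I" by (auto simp: simplices_def \<sigma>)
  have len: "length p = card I" using p distinct_card by fastforce
  have "p \<noteq> []" using p assms(3) by auto
  have ec: "e c = 1 \<or> e c = -1" if "c \<in> I" for c using e that by auto
  consider (last) "j = length p" | (hd) "j = 0" "j \<noteq> length p" | (mid) "0 < j" "j < length p"
    using assms(2) len by linarith
  then show ?thesis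
  proof cases
    case last
    obtain q c where q: "p = q @ [c]" using \<open>p \<noteq> []\<close> by (metis append_butlast_last_id)
    have c: "c \<in> I" "c \<notin> set q" using p q by auto
    show ?thesis
    proof (cases "0 < k c")
      case True
      have [simp]: "\<sigma>' = (k(c := k c - 1), e, c # q)" "j' = 0"
        using eq \<sigma> last q True by (auto simp: mate.simps)
      have "\<sigma>' \<in> simplices"
        using k e p q True c by (auto simp: simplices_def PiE_iff extensional_def)
      moreover have "mate (\<sigma>', j') = (\<sigma>, j)"
        using k c by (auto simp: \<sigma> q last mate.simps)
      moreover have "vert \<sigma>' (skip j' t) = vert \<sigma> (skip j t)" if "t < card I" for t
        using that len c by (auto simp: \<sigma> q skip_def vert.simps last fun_eq_iff dest: in_set_takeD)
      ultimately show ?thesis using last q by auto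
    next
      case False
      then have k0: "k c = 0" using k c by force
      have [simp]: "\<sigma>' = (k, e(c := - e c), p)" "j' = length p"
        using eq \<sigma> last q k0 by (auto simp: mate.simps)
      have "\<sigma>' \<in> simplices"
        using k e p c by (auto simp: simplices_def PiE_iff extensional_def)
      moreover have "mate (\<sigma>', j') = (\<sigma>, j)"
        using k0 by (auto simp: \<sigma> q last mate.simps)
      moreover have "\<sigma>' \<noteq> \<sigma>" using ec[OF c(1)] by (auto simp: \<sigma> dest: fun_cong[of _ _ c])
      moreover have "vert \<sigma>' (skip j' t) = vert \<sigma> (skip j t)" if "t < card I" for t
        using that len c k0 by (auto simp: \<sigma> q skip_def vert.simps last fun_eq_iff dest: in_set_takeD)
      ultimately show ?thesis using len by auto
    qed
  next
    case hd
    obtain c q where q: "p = c # q" using \<open>p \<noteq> []\<close> by (meson neq_Nil_conv)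
    have c: "c \<in> I" "c \<notin> set q" using p q by auto
    show ?thesis
    proof (cases "k c + 1 < m")
      case True
      have [simp]: "\<sigma>' = (k(c := k c + 1), e, q @ [c])" "j' = length p"
        using eq \<sigma> hd q True by (auto simp: mate.simps)
      have "\<sigma>' \<in> simplices"
        using k e p q True c by (auto simp: simplices_def PiE_iff extensional_def)
      moreover have "mate (\<sigma>', j') = (\<sigma>, j)"
      proof -
        have "0 \<le> k c" using k c by force
        then show ?thesis by (auto simp: \<sigma> q hd mate.simps)
      qed
      moreover have "vert \<sigma>' (skip j' t) = vert \<sigma> (skip j t)" if "t < card I" for t
        using that len c by (auto simp: \<sigma> q skip_def vert.simps hd fun_eq_iff dest: in_set_takeD)
      ultimately show ?thesis using hd len by auto
    next
      \<comment> \<open>The facet lies on the rim. Vertices are multiples of \<open>e\<close> in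
        each coordinate, so negating \<open>e\<close> on the block gives the antipodal facet with
        the same vertex order.\<close>
      case False
      then have km: "k c = m - 1" using k c by force
      let ?e = "restrict (flip blk (blk c) e) I"
      have [simp]: "\<sigma>' = (k, ?e, p)" "j' = 0"
        using eq \<sigma> hd q km by (auto simp: mate.simps)
      have "\<sigma>' \<in> simplices"
      proof -
        have "?e \<in> I \<rightarrow>\<^sub>E {1, -1}"
          using ec by (force simp: flip_def)
        then show ?thesis using k p by (simp add: simplices_def)
      qed
      moreover have "restrict (flip blk (blk c) ?e) I = e"
        using e by (auto simp: flip_def fun_eq_iff PiE_iff extensional_def)
      then have "mate (\<sigma>', j') = (\<sigma>, j)"
        using km by (auto simp: \<sigma> q hd mate.simps)
      moreover have "\<sigma>' \<noteq> \<sigma>"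
        using ec[OF c(1)] c by (auto simp: \<sigma> flip_def dest: fun_cong[of _ _ c])
      moreover have "vert \<sigma>' (skip j' t) = flip blk (blk c) (vert \<sigma> (skip j t))" for t
        by (auto simp: \<sigma> hd flip_def vert.simps)
      moreover have "on_rim I blk m (blk c) (vert \<sigma> (skip j t))" for t
        unfolding on_rim_def
      proof (intro conjI ballI bexI[of _ c])
        fix a assume a: "a \<in> I"
        then have "k a \<in> {0..<m}" using k by blast
        then show "\<bar>vert \<sigma> (skip j t) a\<bar> \<le> m"
          using ec[OF a] a by (auto simp: \<sigma> vert.simps abs_mult)
      next
        show "\<bar>vert \<sigma> (skip j t) c\<bar> = m"
          using c m_gt_1 km ec[OF c(1)] by (auto simp: \<sigma> q hd skip_def vert.simps abs_mult)
      qed (use c in auto)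
      moreover have "j' \<le> card I" by simp
      ultimately show ?thesis by blast
    qed
  next
    case mid
    let ?p = "p[j - 1 := p ! j, j := p ! (j - 1)]"
    have [simp]: "\<sigma>' = (k, e, ?p)" "j' = j"
      using eq \<sigma> mid by (auto simp: mate.simps)
    have "\<sigma>' \<in> simplices"
      using k e p mid by (simp add: simplices_def)
    moreover have "?p[j - 1 := ?p ! j, j := ?p ! (j - 1)] = p"
      using mid by (intro nth_equalityI) (auto simp: nth_list_update)
    then have "mate (\<sigma>', j') = (\<sigma>, j)"
      using mid by (simp add: \<sigma> mate.simps)
    moreover have "?p \<noteq> p"
    proof
      assume "?p = p"
      then have "?p ! j = p ! j" by simp
      then show False using mid p by (simp add: nth_eq_iff_index_eq)
    qed
    moreover have "vert \<sigma>' (skip j' t) = vert \<sigma> (skip j t)" for t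
    proof -
      have "set (take i ?p) = set (take i p)" if "i \<noteq> j" for i
      proof (cases "i < j")
        case False
        then have "take i ?p = (take i p)[j - 1 := take i p ! j, j := take i p ! (j - 1)]"
          using that mid by (simp add: take_update_swap)
        moreover have "j - 1 < length (take i p)" "j < length (take i p)"
          using False that mid by auto
        ultimately show ?thesis by (simp only: set_swap)
      qed (simp add: take_update_cancel)
      from this[of "skip j t"] have "set (take (skip j t) ?p) = set (take (skip j t) p)"
        by (simp add: skip_def)
      then show ?thesis by (simp only: \<sigma> vert.simps \<open>\<sigma>' = (k, e, ?p)\<close> \<open>j' = j\<close>)
    qed
    ultimately show ?thesis using mid len by (auto simp: \<sigma>)
  qed
qed

section \<open>Twisted cochains and the invariance of their parity\<close>

definition twisted :: "nat set \<Rightarrow> (('c \<Rightarrow> int) \<Rightarrow> bit) \<Rightarrow> bool"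
  where "twisted B s \<longleftrightarrow> (\<forall>b x. on_rim I blk m b x \<longrightarrow> s (flip blk b x) = s x + of_bool (b \<in> B))"

text \<open>Identifying antipodal rim points in every block gives a product of projective spaces. If
  \<open>twisted B s\<close>, the coboundary of \<open>s\<close> descends to this quotient, in the
  class of the character \<open>B\<close>; \<open>parity\<close> evaluates the cup product on the
  mod 2 fundamental class.\<close>

definition parity :: "(nat \<Rightarrow> ('c \<Rightarrow> int) \<Rightarrow> bit) \<Rightarrow> bit"
  where "parity s = (\<Sum>\<sigma>\<in>simplices. jumps (card I) s (vert \<sigma>))"

text \<open>As \<open>u\<close> descends to the quotient, the product is the coboundary of
  \<open>cup_mid\<close>, which agrees on a facet and its mate. The sum over pairs of simplex and
  facet thus cancels under \<open>mate\<close>.\<close>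

lemma parity_coboundary:
  assumes tw: "\<And>j. j < card I \<Longrightarrow> twisted (B j) (s j)"
    and u: "twisted {} u" and i: "i < card I"
  shows "parity (s(i := u)) = 0"
proof -
  obtain n where n: "card I = Suc (i + n)" using i less_imp_Suc_add by blast
  have "I \<noteq> {}" using i by auto
  let ?f = "\<lambda>(\<sigma>, j). cup_mid i n s u (vert \<sigma> \<circ> skip j)"
  let ?S = "simplices \<times> {..card I}"
  have inv: "mate x \<in> ?S \<and> mate (mate x) = x \<and> mate x \<noteq> x \<and> ?f (mate x) = ?f x" if "x \<in> ?S" for x
  proof -
    obtain \<sigma> j where x: "x = (\<sigma>, j)" by (cases x)
    obtain \<sigma>' j' where m: "mate (\<sigma>, j) = (\<sigma>', j')" by (cases "mate (\<sigma>, j)")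
    have "\<sigma> \<in> simplices" "j \<le> card I" using that x by auto
    note M = mate[OF this \<open>I \<noteq> {}\<close> m]
    have "cup_mid i n s u (vert \<sigma>' \<circ> skip j') = cup_mid i n s u (vert \<sigma> \<circ> skip j)"
    proof -
      let ?F = "vert \<sigma> \<circ> skip j" and ?F' = "vert \<sigma>' \<circ> skip j'"
      have "(\<forall>t<card I. ?F' t = ?F t) \<or>
          (\<exists>b. \<forall>t<card I. on_rim I blk m b (?F t) \<and> ?F' t = flip blk b (?F t))"
        using M[THEN conjunct2, THEN conjunct2, THEN conjunct2, THEN conjunct2]
        unfolding comp_apply .
      then show ?thesis
      proof (elim disjE exE)
        assume 1: "\<forall>t<card I. ?F' t = ?F t"
        then show ?thesis
          unfolding cup_mid_def n by (intro arg_cong2[of _ _ _ _ "(*)"] jumps_cong) auto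
      next
        fix b
        assume 2: "\<forall>t<card I. on_rim I blk m b (?F t) \<and> ?F' t = flip blk b (?F t)"
        \<comment> \<open>The twist enters at both ends of an edge.\<close>
        have cancel: "(a + c) + (b + c) = a + b" for a b c :: bit
          by (cases a; cases b; cases c) auto
        have "u (?F' i) = u (?F i)"
          using u 2 i by (simp add: twisted_def)
        moreover have "s t (?F' t') + s t (?F' (Suc t')) = s t (?F t') + s t (?F (Suc t'))"
          if "t < card I" "Suc t' < card I" for t t'
        proof -
          have "s t (?F' l) = s t (?F l) + of_bool (b \<in> B t)" if "l < card I" for l
            using tw[OF \<open>t < card I\<close>] 2 that by (simp add: twisted_def)
          from this[of t'] this[of "Suc t'"] show ?thesis
            using that(2) by (simp only: cancel Suc_lessD)
        qed
        ultimately show ?thesis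
          unfolding cup_mid_def jumps_def n
          by (intro arg_cong2[of _ _ _ _ "(*)"] prod.cong refl) auto
      qed
    qed
    moreover note M[THEN conjunct1] M[THEN conjunct2, THEN conjunct1]
      M[THEN conjunct2, THEN conjunct2, THEN conjunct1]
      M[THEN conjunct2, THEN conjunct2, THEN conjunct2, THEN conjunct1]
    ultimately show ?thesis unfolding x m by simp
  qed
  have "parity (s(i := u)) = (\<Sum>\<sigma>\<in>simplices. \<Sum>j\<le>card I. cup_mid i n s u (vert \<sigma> \<circ> skip j))"
    unfolding parity_def n cup_mid_coboundary ..
  also have "\<dots> = (\<Sum>x\<in>?S. ?f x)"
    by (rule sum.cartesian_product)
  also have "\<dots> = 0"
  proof (rule sum_bit_involution[of _ mate])
    show "finite ?S" using finite_simplices by simp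
    fix x assume "x \<in> ?S"
    note * = inv[OF this]
    show "mate x \<in> ?S" using * by (rule conjunct1)
    show "mate (mate x) = x" using *[THEN conjunct2] by (rule conjunct1)
    show "mate x \<noteq> x" using *[THEN conjunct2, THEN conjunct2] by (rule conjunct1)
    show "?f (mate x) = ?f x" using *[THEN conjunct2, THEN conjunct2] by (rule conjunct2)
  qed
  finally show ?thesis .
qed

lemma parity_add:
  assumes "i < card I"
  shows "parity (s(i := \<lambda>x. u x + u' x)) = parity (s(i := u)) + parity (s(i := u'))"
proof -
  have "jumps N (s(i := \<lambda>x. u x + u' x)) v = jumps N (s(i := u)) v + jumps N (s(i := u')) v"
    if "i < N" for N v
  proof -
    have "(\<Prod>t<N. h t) = h i * (\<Prod>t\<in>{..<N} - {i}. h t)" for h :: "nat \<Rightarrow> bit"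
      using that by (simp add: prod.remove)
    then have *: "jumps N (s(i := w)) v =
        (w (v i) + w (v (Suc i))) * (\<Prod>t\<in>{..<N} - {i}. s t (v t) + s t (v (Suc t)))" for w
      unfolding jumps_def by (auto intro!: arg_cong2[of _ _ _ _ "(*)"] prod.cong)
    show ?thesis
      unfolding * by (simp only: distrib_right ac_simps)
  qed
  then show ?thesis
    unfolding parity_def using assms by (simp only: sum.distrib)
qed

text \<open>The cochains are exchanged one at a time. By additivity in the slot \<open>i\<close> the
  parity changes by that of \<open>s i + s' i\<close>, and this sum is untwisted.\<close>

lemma parity_unique:
  assumes "\<And>j. j < card I \<Longrightarrow> twisted (B j) (s j)" and "\<And>j. j < card I \<Longrightarrow> twisted (B j) (s' j)"
  shows "parity s = parity s'"
proof -
  define h where "h i = (\<lambda>j. if j < i then s' j else s j)" for i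
  have "parity (h i) = parity s" if "i \<le> card I" for i
    using that
  proof (induction i)
    case 0
    show ?case by (simp add: h_def)
  next
    case (Suc i)
    then have i: "i < card I" by simp
    have cancel: "a + c + (b + c) = a + b" for a b c :: bit
      by (cases a; cases b; cases c) auto
    have "s i (flip blk b x) + s' i (flip blk b x) = s i x + s' i x + of_bool (b \<in> {})"
      if "on_rim I blk m b x" for b x
      using assms[OF i] that unfolding twisted_def by (simp only: cancel) simp
    then have "twisted {} (\<lambda>x. s i x + s' i x)"
      by (simp only: twisted_def) blast
    then have "parity ((h i)(i := \<lambda>x. s i x + s' i x)) = 0"
      by (intro parity_coboundary[where B = B]) (use i assms in \<open>auto simp: h_def\<close>)
    moreover have "(h i)(i := s i) = h i" "(h i)(i := s' i) = h (Suc i)"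
      by (auto simp: h_def fun_eq_iff)
    ultimately have "parity (h i) = parity (h (Suc i))"
      by (simp only: parity_add[OF i] bit_add_eq_0_iff)
    then show ?case using Suc by simp
  qed
  moreover have "parity (h (card I)) = parity s'"
    unfolding parity_def by (intro sum.cong jumps_cong) (auto simp: h_def)
  ultimately show ?thesis by simp
qed

section \<open>Model cochains with parity 1\<close>

text \<open>On the rim of block \<open>b\<close> the cochain \<open>pole b\<close> is an arbitrary odd sign; in the interior it is the sign
  of the positive last coordinate of the hemisphere. It also breaks ties in \<open>coord_sign\<close>.\<close>

definition pole :: "nat \<Rightarrow> ('c \<Rightarrow> int) \<Rightarrow> bit"
  where "pole b x = of_bool (on_rim I blk m b x \<and> x (SOME c. c \<in> I \<and> blk c = b \<and> \<bar>x c\<bar> = m) < 0)"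

definition coord_sign :: "'c \<Rightarrow> ('c \<Rightarrow> int) \<Rightarrow> bit"
  where "coord_sign c x = (if x c = 0 then pole (blk c) x else of_bool (x c < 0))"

text \<open>The model for a component whose sign changes with the block of \<open>c\<close> and with
  each block in \<open>R c\<close>.\<close>

definition std :: "('c \<Rightarrow> nat set) \<Rightarrow> 'c \<Rightarrow> ('c \<Rightarrow> int) \<Rightarrow> bit"
  where "std R c x = coord_sign c x + (\<Sum>b\<in>R c. pole b x)"

lemma twisted_add:
  assumes "twisted B s" "twisted B' s'" "B \<inter> B' = {}"
  shows "twisted (B \<union> B') (\<lambda>x. s x + s' x)"
proof -
  have "s (flip blk b x) + s' (flip blk b x) = s x + s' x + of_bool (b \<in> B \<union> B')"
    if "on_rim I blk m b x" for b x
  proof -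
    have "of_bool (b \<in> B \<union> B') = (of_bool (b \<in> B) + of_bool (b \<in> B') :: bit)"
      using assms(3) by auto
    moreover have "s (flip blk b x) = s x + of_bool (b \<in> B)" "s' (flip blk b x) = s' x + of_bool (b \<in> B')"
      using assms(1,2) that unfolding twisted_def by blast+
    ultimately show ?thesis by (simp only: ac_simps)
  qed
  then show ?thesis by (simp only: twisted_def) blast
qed

lemma twisted_pole: "twisted {b} (pole b)"
  unfolding twisted_def
proof (intro allI impI)
  fix b' x assume x: "on_rim I blk m b' x"
  have abs: "\<bar>flip blk b' x c\<bar> = \<bar>x c\<bar>" for c by (simp add: flip_def)
  \<comment> \<open>The choice depends only on absolute values, so flips preserve it; the chosen
    value has modulus \<open>m > 0\<close>, so its sign is reversed when its block is
    flipped.\<close>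
  let ?c = "SOME c. c \<in> I \<and> blk c = b \<and> \<bar>x c\<bar> = m"
  have rim: "on_rim I blk m b (flip blk b' x) \<longleftrightarrow> on_rim I blk m b x"
    by (simp add: on_rim_def abs)
  show "pole b (flip blk b' x) = pole b x + of_bool (b' \<in> {b})"
  proof (cases "on_rim I blk m b x")
    case True
    then have "\<exists>c. c \<in> I \<and> blk c = b \<and> \<bar>x c\<bar> = m" by (auto simp: on_rim_def)
    then have "blk ?c = b" "\<bar>x ?c\<bar> = m"
      by (metis (mono_tags, lifting) someI_ex)+
    then show ?thesis
      using m_gt_1 True unfolding pole_def rim abs by (auto simp: flip_def)
  next
    case False
    then show ?thesis using x unfolding pole_def rim by auto
  qed
qed

lemma twisted_coord_sign: "twisted {blk c} (coord_sign c)"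
  unfolding twisted_def
proof (intro allI impI)
  fix b x assume x: "on_rim I blk m b x"
  have "pole (blk c) (flip blk b x) = pole (blk c) x + of_bool (b \<in> {blk c})"
    using twisted_pole x unfolding twisted_def by blast
  then show "coord_sign c (flip blk b x) = coord_sign c x + of_bool (b \<in> {blk c})"
    by (auto simp: coord_sign_def flip_def)
qed

lemma twisted_std:
  assumes "R c \<subseteq> {..<blk c}"
  shows "twisted (insert (blk c) (R c)) (std R c)"
proof -
  have "finite (R c)" using assms finite_subset by blast
  then have "twisted (R c) (\<lambda>x. \<Sum>b\<in>R c. pole b x)"
  proof (induction rule: finite_induct)
    case empty
    show ?case by (simp add: twisted_def)
  next
    case (insert b F)
    then show ?case using twisted_add[OF twisted_pole[of b] insert.IH] by simp
  qed
  then have "twisted ({blk c} \<union> R c) (\<lambda>x. coord_sign c x + (\<Sum>b\<in>R c. pole b x))"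
    using assms by (intro twisted_add twisted_coord_sign) auto
  then show ?thesis by (simp add: std_def[abs_def])
qed

text \<open>By induction on the block: the simplex stays away from the rim of the smaller blocks, so there
  the cochains \<open>pole\<close> vanish; and if it met the rim of its block in the coordinate \<open>c\<close>, that
  coordinate would keep its sign.\<close>

lemma std_jumps_unique:
  assumes R: "\<And>c. c \<in> I \<Longrightarrow> R c \<subseteq> {..<blk c}"
    and cs: "distinct cs" "set cs = I" and \<sigma>: "(k, e, p) \<in> simplices"
    and jump: "\<And>t. t < card I \<Longrightarrow>
      std R (cs ! t) (vert (k, e, p) t) \<noteq> std R (cs ! t) (vert (k, e, p) (Suc t))"
    and t: "t < card I"
  shows "k (cs ! t) = 0 \<and> e (cs ! t) = -1 \<and> p ! t = cs ! t"
  using t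
proof (induction "blk (cs ! t)" arbitrary: t rule: less_induct)
  case (less t)
  let ?v = "vert (k, e, p)"
  let ?b = "blk (cs ! t)"
  have len: "length cs = card I" using cs distinct_card by fastforce
  have p: "distinct p" "set p = I" and k: "k \<in> I \<rightarrow>\<^sub>E {0..<m}" and e: "e \<in> I \<rightarrow>\<^sub>E {1, -1}"
    using \<sigma> by (auto simp: simplices_def)
  have lenp: "length p = card I" using p distinct_card by fastforce
  have inI: "cs ! t' \<in> I" if "t' < card I" for t' using that cs len by auto
  have ec: "e c = 1 \<or> e c = -1" if "c \<in> I" for c using e that by auto
  have k0: "0 \<le> k c" if "c \<in> I" for c using k that by force
  \<comment> \<open>By the induction hypothesis the coordinates of the smaller blocks take only the
    values \<open>0\<close> and \<open>-1\<close> on this simplex.\<close>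
  have pole0: "pole b (?v j) = 0" if "b < ?b" for b j
  proof -
    have "\<not> on_rim I blk m b (?v j)"
    proof
      assume "on_rim I blk m b (?v j)"
      then obtain c where c: "c \<in> I" "blk c = b" "\<bar>?v j c\<bar> = m" by (auto simp: on_rim_def)
      then obtain t' where t': "t' < card I" "c = cs ! t'" using cs len by (metis in_set_conv_nth)
      then have "k c = 0" "e c = -1" using less.hyps[of t'] c \<open>b < ?b\<close> by auto
      then show False using c m_gt_1 by (cases "c \<in> set (take j p)") (auto simp: vert.simps)
    qed
    then show ?thesis by (simp add: pole_def)
  qed
  have std_eq: "std R c (?v j) = coord_sign c (?v j)" if "c \<in> I" "blk c = ?b" for c j
  proof -
    have "(\<Sum>b\<in>R c. pole b (?v j)) = 0"
      using R[OF that(1)] that(2) by (intro sum.neutral ballI pole0) auto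
    then show ?thesis unfolding std_def by simp
  qed
  have "\<not> on_rim I blk m ?b (?v j)" for j
  proof
    assume "on_rim I blk m ?b (?v j)"
    then obtain c where c: "c \<in> I" "blk c = ?b" "\<bar>?v j c\<bar> = m" by (auto simp: on_rim_def)
    then obtain t' where t': "t' < card I" "c = cs ! t'" using cs len by (metis in_set_conv_nth)
    have "\<bar>e c\<bar> = 1" using ec[OF c(1)] by auto
    then have "\<bar>k c + of_bool (c \<in> set (take j p))\<bar> = m" using c by (simp add: vert.simps abs_mult)
    \<comment> \<open>Because \<open>1 < m\<close>, a single step from \<open>0\<close> does not
      reach the rim.\<close>
    then have "0 < k c"
      using k0[OF c(1)] m_gt_1 by (cases "c \<in> set (take j p)") auto
    then have "coord_sign c (?v i) = of_bool (e c < 0)" for i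
      using ec[OF c(1)] c(1) by (auto simp: coord_sign_def vert.simps)
    then show False
      using jump[OF t'(1)] std_eq[OF c(1,2)] by (simp only: t'(2)[symmetric] simp_thms)
  qed
  then have "pole ?b (?v j) = 0" for j by (simp add: pole_def)
  then have sgn: "coord_sign (cs ! t) (?v j) = of_bool (?v j (cs ! t) < 0)" for j
    by (auto simp: coord_sign_def)
  \<comment> \<open>Only a step from \<open>0\<close> to \<open>-1\<close> changes this truth value,
    so step \<open>t\<close> must be in the direction \<open>cs ! t\<close>.\<close>
  have "(?v t (cs ! t) < 0) \<noteq> (?v (Suc t) (cs ! t) < 0)"
    using jump[OF less.prems] unfolding std_eq[OF inI[OF less.prems] refl] sgn by auto
  moreover have "set (take (Suc t) p) = insert (p ! t) (set (take t p))"
    using less.prems lenp by (simp add: take_Suc_conv_app_nth)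
  ultimately show ?case
    using ec[OF inI[OF less.prems]] k0[OF inI[OF less.prems]] inI[OF less.prems]
    by (cases "cs ! t \<in> set (take t p)"; cases "p ! t = cs ! t") (auto simp: vert.simps)
qed

text \<open>\<open>std_jumps_unique\<close> leaves only the simplex that starts at \<open>0\<close>
  and steps to \<open>-1\<close> in the order \<open>cs\<close>, and there every cochain does
  jump.\<close>

lemma parity_std:
  assumes R: "\<And>c. c \<in> I \<Longrightarrow> R c \<subseteq> {..<blk c}" and cs: "distinct cs" "set cs = I"
  shows "parity (\<lambda>t. std R (cs ! t)) = 1"
proof -
  let ?s = "\<lambda>t. std R (cs ! t)"
  define \<sigma>0 where "\<sigma>0 = (restrict (\<lambda>_. 0) I :: 'c \<Rightarrow> int, restrict (\<lambda>_. -1) I :: 'c \<Rightarrow> int, cs)"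
  have len: "length cs = card I" using cs distinct_card by fastforce
  have \<sigma>0: "\<sigma>0 \<in> simplices" using cs m_gt_1 by (auto simp: simplices_def \<sigma>0_def)
  have v: "vert \<sigma>0 j = (\<lambda>c. if c \<in> set (take j cs) then -1 else 0)" for j
    using cs by (auto simp: \<sigma>0_def vert.simps fun_eq_iff dest: in_set_takeD)
  have "\<not> on_rim I blk m b (vert \<sigma>0 j)" for b j
    using m_gt_1 by (auto simp: on_rim_def v split: if_splits)
  then have "pole b (vert \<sigma>0 j) = 0" for b j by (simp add: pole_def)
  then have s0: "std R c (vert \<sigma>0 j) = of_bool (c \<in> set (take j cs))" for c j
    by (auto simp: std_def coord_sign_def v)
  have "jumps (card I) ?s (vert \<sigma>0) = 1"
    unfolding jumps_eq_1_iff s0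
  proof (intro allI impI)
    fix t assume "t < card I"
    then have "set (take (Suc t) cs) = insert (cs ! t) (set (take t cs))" "cs ! t \<notin> set (take t cs)"
      using len cs by (auto simp: take_Suc_conv_app_nth in_set_conv_nth nth_eq_iff_index_eq)
    then show "of_bool (cs ! t \<in> set (take t cs)) \<noteq> (of_bool (cs ! t \<in> set (take (Suc t) cs)) :: bit)"
      by simp
  qed
  moreover have "jumps (card I) ?s (vert \<sigma>) = 0" if "\<sigma> \<in> simplices - {\<sigma>0}" for \<sigma>
  proof (rule ccontr)
    obtain k e p where [simp]: "\<sigma> = (k, e, p)" by (cases \<sigma>)
    assume "jumps (card I) ?s (vert \<sigma>) \<noteq> 0"
    then have "\<And>t. t < card I \<Longrightarrow> ?s t (vert (k, e, p) t) \<noteq> ?s t (vert (k, e, p) (Suc t))"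
      by (simp add: jumps_eq_1_iff)
    note u = std_jumps_unique[OF R cs _ this]
    have \<sigma>: "(k, e, p) \<in> simplices" using that by simp
    then have keI: "k \<in> extensional I" "e \<in> extensional I" "length p = card I"
      using distinct_card[of p] by (auto simp: simplices_def PiE_iff)
    have "p = cs" using u \<sigma> keI(3) len by (intro nth_equalityI) auto
    moreover have "k c = 0" "e c = -1" if "c \<in> I" for c
      using that cs len u \<sigma> by (metis in_set_conv_nth)+
    then have "k = restrict (\<lambda>_. 0) I" "e = restrict (\<lambda>_. -1) I"
      using keI by (auto simp: fun_eq_iff extensional_def)
    ultimately show False using that by (simp add: \<sigma>0_def)
  qed
  ultimately show ?thesis
    unfolding parity_def by (subst sum.remove[OF finite_simplices \<sigma>0]) simp
qed

text \<open>The parity is that of the model, hence nonzero. In cohomology: the smaller blocks have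
  already used up the top powers of their classes, so the terms from \<open>R c\<close> drop out and
  a product of top powers remains.\<close>

lemma exists_all_jumps:
  assumes R: "\<And>c. c \<in> I \<Longrightarrow> R c \<subseteq> {..<blk c}" and cs: "distinct cs" "set cs = I"
    and s: "\<And>t. t < card I \<Longrightarrow> twisted (insert (blk (cs ! t)) (R (cs ! t))) (s t)"
  shows "\<exists>\<sigma>\<in>simplices. \<forall>t<card I. s t (vert \<sigma> t) \<noteq> s t (vert \<sigma> (Suc t))"
proof -
  have len: "length cs = card I" using cs distinct_card by fastforce
  have "parity s = parity (\<lambda>t. std R (cs ! t))"
    using cs len by (intro parity_unique[OF s] twisted_std R) auto
  also have "\<dots> \<noteq> 0" using parity_std[OF R cs] by simp
  finally obtain \<sigma> where "\<sigma> \<in> simplices" "jumps (card I) s (vert \<sigma>) \<noteq> 0"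
    unfolding parity_def by (meson sum.not_neutral_contains_not_neutral)
  then show ?thesis by (auto simp: jumps_eq_1_iff)
qed

end

section \<open>Common zeros on a cube with antipodal rims\<close>

lemma tendsto_fun_iff:
  fixes X :: "'n \<Rightarrow> 'i \<Rightarrow> 'b::topological_space"
  shows "(X \<longlongrightarrow> l) F \<longleftrightarrow> (\<forall>i. ((\<lambda>n. X n i) \<longlongrightarrow> l i) F)"
proof -
  have "limitin (product_topology (\<lambda>_. euclidean) UNIV) X l F \<longleftrightarrow> (\<forall>i. ((\<lambda>n. X n i) \<longlongrightarrow> l i) F)"
    unfolding limitin_componentwise by simp
  then show ?thesis
    unfolding euclidean_product_topology by simp
qed

lemma compact_cube: "compact {y :: 'c::countable \<Rightarrow> real. \<forall>c. \<bar>y c\<bar> \<le> 1}"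
proof -
  have "compactin (powertop_real UNIV) (UNIV \<rightarrow>\<^sub>E {-1..1::real} :: ('c \<Rightarrow> real) set)"
    by (simp add: compactin_PiE)
  moreover have "(UNIV \<rightarrow>\<^sub>E {-1..1}) = {y :: 'c \<Rightarrow> real. \<forall>c. \<bar>y c\<bar> \<le> 1}"
    by (auto simp: PiE_def abs_le_iff minus_le_iff)
  ultimately show ?thesis
    by (simp add: euclidean_product_topology)
qed

text \<open>Sign changes on ever finer grids accumulate at a common zero. Countability of the index
  type makes the function space metric, so the compact cube is sequentially compact.\<close>

theorem cube_common_zero:
  fixes g :: "'c::countable \<Rightarrow> ('c \<Rightarrow> real) \<Rightarrow> real" and blk :: "'c \<Rightarrow> nat"
  assumes "finite I" and R: "\<And>c. c \<in> I \<Longrightarrow> R c \<subseteq> {..<blk c}"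
    and cont: "\<And>c. c \<in> I \<Longrightarrow> continuous_on {y. \<forall>c. \<bar>y c\<bar> \<le> 1} (g c)"
    and odd: "\<And>c b y. c \<in> I \<Longrightarrow> on_rim I blk 1 b y \<Longrightarrow>
      g c (flip blk b y) = (if b \<in> insert (blk c) (R c) then - g c y else g c y)"
  shows "\<exists>y. \<forall>c\<in>I. g c y = 0"
proof -
  obtain cs where cs: "distinct cs" "set cs = I"
    using finite_distinct_list[OF assms(1)] by blast
  then have len: "length cs = card I" using distinct_card by fastforce
  let ?C = "{y :: 'c \<Rightarrow> real. \<forall>c. \<bar>y c\<bar> \<le> 1}"
  have step: "\<forall>n. \<exists>Y. \<forall>t\<le>card I. Y t \<in> ?C \<and> (\<forall>c. \<bar>Y t c - Y 0 c\<bar> \<le> inverse (real (Suc n))) \<and>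
      (t < card I \<longrightarrow> g (cs ! t) (Y t) * g (cs ! t) (Y (Suc t)) \<le> 0)"
  proof
    fix n
    let ?m = "int n + 2"
    interpret cube_grid I blk ?m
      by standard (use assms(1) in auto)
    define sc where "sc x = (\<lambda>c. real_of_int (x c) / real_of_int ?m)" for x :: "'c \<Rightarrow> int"
    \<comment> \<open>Where \<open>g c\<close> vanishes, the model cochain supplies a sign with the
      same twist. A jump still forces the product of the two values of \<open>g c\<close> to be at
      most \<open>0\<close>.\<close>
    define s where "s c x = (if g c (sc x) = 0 then std R c x else of_bool (g c (sc x) < 0))" for c x
    have tw: "twisted (insert (blk c) (R c)) (s c)" if c: "c \<in> I" for c
      unfolding twisted_def
    proof (intro allI impI)
      fix b x assume x: "on_rim I blk ?m b x"
      have "\<bar>sc x a\<bar> = real_of_int \<bar>x a\<bar> / real_of_int ?m" for a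
        by (simp add: sc_def abs_divide)
      then have "on_rim I blk 1 b (sc x)"
        using x unfolding on_rim_def by (auto simp: divide_le_eq)
      moreover have "sc (flip blk b x) = flip blk b (sc x)"
        by (auto simp: sc_def flip_def)
      ultimately have "g c (sc (flip blk b x)) =
          (if b \<in> insert (blk c) (R c) then - g c (sc x) else g c (sc x))"
        using odd[OF c] by simp
      moreover have "std R c (flip blk b x) = std R c x + of_bool (b \<in> insert (blk c) (R c))"
        using twisted_std[of R c, OF R[OF c]] x unfolding twisted_def by blast
      ultimately show "s c (flip blk b x) = s c x + of_bool (b \<in> insert (blk c) (R c))"
        unfolding s_def by auto
    qed
    obtain \<sigma> where \<sigma>: "\<sigma> \<in> simplices"
      and jump: "\<forall>t<card I. s (cs ! t) (vert \<sigma> t) \<noteq> s (cs ! t) (vert \<sigma> (Suc t))"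
      using exists_all_jumps[OF R cs, of "\<lambda>t. s (cs ! t)"] tw cs len by auto
    obtain k e p where [simp]: "\<sigma> = (k, e, p)" by (cases \<sigma>)
    have kI: "k c \<in> {0..<?m}" and eI: "e c = 1 \<or> e c = -1" if "c \<in> I" for c
      using \<sigma> that by (auto simp: simplices_def)
    define Y where "Y t = sc (vert \<sigma> t)" for t
    have "\<bar>vert \<sigma> t c\<bar> \<le> ?m" for t c
      using kI[of c] eI[of c] by (cases "c \<in> set (take t p)") (auto simp: vert.simps)
    then have "real_of_int \<bar>vert \<sigma> t c\<bar> \<le> real_of_int ?m" for t c
      by (simp only: of_int_le_iff)
    then have "Y t \<in> ?C" for t
      by (simp add: Y_def sc_def abs_divide divide_le_eq)
    moreover have "\<bar>Y t c - Y 0 c\<bar> \<le> inverse (real (Suc n))" for t c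
    proof -
      have "\<bar>vert \<sigma> t c - vert \<sigma> 0 c\<bar> \<le> 1"
        using eI[of c] by (cases "c \<in> set (take t p)") (auto simp: vert.simps algebra_simps)
      then have "\<bar>real_of_int (vert \<sigma> t c - vert \<sigma> 0 c)\<bar> \<le> 1" by linarith
      then have "\<bar>real_of_int (vert \<sigma> t c - vert \<sigma> 0 c) / real_of_int ?m\<bar> \<le> 1 / real_of_int ?m"
        unfolding abs_divide by (intro frac_le) auto
      also have "\<dots> \<le> inverse (real (Suc n))"
        by (simp add: field_simps)
      finally show ?thesis by (simp add: Y_def sc_def diff_divide_distrib)
    qed
    moreover have "g (cs ! t) (Y t) * g (cs ! t) (Y (Suc t)) \<le> 0" if "t < card I" for t
    proof (rule ccontr)
      assume "\<not> ?thesis"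
      then have "0 < g (cs ! t) (Y t) * g (cs ! t) (Y (Suc t))" by simp
      then have "s (cs ! t) (vert \<sigma> t) = s (cs ! t) (vert \<sigma> (Suc t))"
        by (auto simp: s_def Y_def zero_less_mult_iff)
      then show False using jump that by blast
    qed
    ultimately show "\<exists>Y. \<forall>t\<le>card I. Y t \<in> ?C \<and> (\<forall>c. \<bar>Y t c - Y 0 c\<bar> \<le> inverse (real (Suc n))) \<and>
        (t < card I \<longrightarrow> g (cs ! t) (Y t) * g (cs ! t) (Y (Suc t)) \<le> 0)"
      by blast
  qed
  from choice[OF step] obtain Y where "\<forall>n. \<forall>t\<le>card I. Y n t \<in> ?C \<and>
      (\<forall>c. \<bar>Y n t c - Y n 0 c\<bar> \<le> inverse (real (Suc n))) \<and>
      (t < card I \<longrightarrow> g (cs ! t) (Y n t) * g (cs ! t) (Y n (Suc t)) \<le> 0)"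
    by blast
  then have Y: "\<And>n t. t \<le> card I \<Longrightarrow> Y n t \<in> ?C"
    "\<And>n t c. t \<le> card I \<Longrightarrow> \<bar>Y n t c - Y n 0 c\<bar> \<le> inverse (real (Suc n))"
    "\<And>n t. t < card I \<Longrightarrow> g (cs ! t) (Y n t) * g (cs ! t) (Y n (Suc t)) \<le> 0"
    by simp_all
  have "seq_compact ?C" using compact_cube compact_eq_seq_compact_metric by blast
  moreover have "\<forall>n. Y n 0 \<in> ?C" using Y(1) by blast
  ultimately obtain y r where y: "y \<in> ?C" "strict_mono r" "((\<lambda>n. Y n 0) \<circ> r) \<longlonglongrightarrow> y"
    by (rule seq_compactE)
  have lim: "(\<lambda>n. Y (r n) t) \<longlonglongrightarrow> y" if t: "t \<le> card I" for t
    unfolding tendsto_fun_iff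
  proof
    fix c
    have "(\<lambda>n. inverse (real (Suc (r n)))) \<longlonglongrightarrow> 0"
      using LIMSEQ_subseq_LIMSEQ[OF LIMSEQ_inverse_real_of_nat y(2)] by (simp add: comp_def)
    then have "(\<lambda>n. Y (r n) t c - Y (r n) 0 c) \<longlonglongrightarrow> 0"
      by (rule Lim_null_comparison[rotated]) (use Y(2)[OF t] in \<open>simp add: eventually_sequentially\<close>)
    moreover have "(\<lambda>n. Y (r n) 0 c) \<longlonglongrightarrow> y c"
      using y(3) by (simp add: tendsto_fun_iff)
    ultimately show "(\<lambda>n. Y (r n) t c) \<longlonglongrightarrow> y c"
      using tendsto_add by fastforce
  qed
  have "g c y = 0" if c: "c \<in> I" for c
  proof -
    obtain t where t: "t < card I" "c = cs ! t" using c cs len by (metis in_set_conv_nth)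
    have glim: "(\<lambda>n. g c (Y (r n) l)) \<longlonglongrightarrow> g c y" if "l \<le> card I" for l
      using continuous_on_tendsto_compose[OF cont[OF c] lim[OF that] y(1)] Y(1)[OF that] by simp
    have "(\<lambda>n. g c (Y (r n) t) * g c (Y (r n) (Suc t))) \<longlonglongrightarrow> g c y * g c y"
      using t by (intro tendsto_mult glim) auto
    then have "g c y * g c y \<le> 0"
      by (rule LIMSEQ_le_const2) (use Y(3) t in auto)
    then show ?thesis by (auto simp: mult_le_0_iff)
  qed
  then show ?thesis by blast
qed

section \<open>Spheres and Stiefel manifolds\<close>

text \<open>The hemisphere of the \<open>i\<close>-th sphere is centred at the basis vector with index \<open>d - i\<close>: the components
  of \<open>f\<close> are matched with the coordinates \<open>a < d - i\<close> of \<open>v\<^sub>i\<close>, and the inner product of \<open>v\<^sub>i\<close> and \<open>v\<^sub>j\<close>,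
  \<open>j < i\<close>, with the coordinate \<open>a = d - j\<close>, in which \<open>v\<^sub>j\<close> is centred.\<close>

definition hemisphere :: "nat \<Rightarrow> (nat \<times> nat \<Rightarrow> real) \<Rightarrow> nat \<Rightarrow> nat \<Rightarrow> real"
  where "hemisphere d y i a =
    (if a = d - i then \<Prod>a'\<in>{..<d} - {d - i}. 1 - (y (i, a'))\<^sup>2 else if a < d then y (i, a) else 0)"

definition sphere_point :: "nat \<Rightarrow> (nat \<times> nat \<Rightarrow> real) \<Rightarrow> nat \<Rightarrow> nat \<Rightarrow> real"
  where "sphere_point d y i a = hemisphere d y i a / sqrt (\<Sum>m\<le>d. (hemisphere d y i m)\<^sup>2)"

text \<open>If all other coordinates vanish, the product in the centre coordinate is
  \<open>1\<close>; so \<open>sphere_point\<close> never divides by \<open>0\<close>.\<close>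

lemma hemisphere_pos: "0 < (\<Sum>m\<le>d. (hemisphere d y i m)\<^sup>2)"
proof -
  have "\<exists>m\<le>d. hemisphere d y i m \<noteq> 0"
  proof (rule ccontr)
    assume "\<not> ?thesis"
    then have 0: "hemisphere d y i m = 0" if "m \<le> d" for m using that by blast
    have "y (i, m) = 0" if "m \<in> {..<d} - {d - i}" for m
      using 0[of m] that by (simp add: hemisphere_def)
    then have "hemisphere d y i (d - i) = 1" by (simp add: hemisphere_def)
    then show False using 0[of "d - i"] by simp
  qed
  then obtain m where "m \<le> d" "hemisphere d y i m \<noteq> 0" by blast
  then show ?thesis by (intro sum_pos2[of _ m]) auto
qed

lemma sphere_point_norm: "(\<Sum>m\<le>d. (sphere_point d y i m)\<^sup>2) = 1"
  using hemisphere_pos[of d y i]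
  by (simp add: sphere_point_def power_divide real_sqrt_pow2 flip: sum_divide_distrib)

lemma sphere_point_eq_0: "d < a \<or> 0 < i \<and> 0 < d \<and> d \<le> a \<Longrightarrow> sphere_point d y i a = 0"
  by (auto simp: sphere_point_def hemisphere_def)

lemma continuous_on_sphere_point: "continuous_on S (\<lambda>y. sphere_point d y i a)"
proof -
  have "continuous_on S (\<lambda>y. hemisphere d y i m)" for m
    unfolding hemisphere_def
    by (cases "m = d - i"; cases "m < d")
      (auto intro!: continuous_intros continuous_on_subset[OF continuous_on_product_coordinates])
  moreover have "sqrt (\<Sum>m\<le>d. (hemisphere d y i m)\<^sup>2) \<noteq> 0" for y
    using hemisphere_pos[of d y i] by simp
  ultimately show ?thesis
    unfolding sphere_point_def by (intro continuous_intros) auto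
qed

text \<open>For \<open>k \<le> d\<close> these are \<open>d + k(d - 1)\<close> coordinates, as many
  as the \<open>(k + 1)d - k(k + 1)/2\<close> components of \<open>f\<close> and the
  \<open>k(k - 1)/2\<close> inner products together.\<close>

definition cells :: "nat \<Rightarrow> nat \<Rightarrow> (nat \<times> nat) set"
  where "cells k d = {(i, a). i \<le> k \<and> a < d \<and> a \<noteq> d - i}"

definition negate :: "nat set \<Rightarrow> (nat \<Rightarrow> nat \<Rightarrow> real) \<Rightarrow> nat \<Rightarrow> nat \<Rightarrow> real"
  where "negate B w = (\<lambda>i a. if i \<in> B then - w i a else w i a)"

text \<open>On the rim a factor \<open>1 - y\<^sup>2\<close> vanishes, so the centre coordinate is
  \<open>0\<close> and equals its own negative.\<close>

lemma sphere_point_flip: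
  assumes "on_rim (cells k d) fst 1 b y"
  shows "sphere_point d (flip fst b y) = negate {b} (sphere_point d y)"
proof -
  obtain a where a: "a < d" "a \<noteq> d - b" "\<bar>y (b, a)\<bar> = 1"
    using assms by (auto simp: on_rim_def cells_def)
  then have "1 - (y (b, a))\<^sup>2 = 0" by (metis cancel_comm_monoid_add_class.diff_cancel one_power2 power2_abs)
  then have "(\<Prod>a'\<in>{..<d} - {d - b}. 1 - (y (b, a'))\<^sup>2) = 0"
    using a by (intro prod_zero) auto
  then have "hemisphere d (flip fst b y) i m = negate {b} (hemisphere d y) i m" for i m
    by (auto simp: hemisphere_def flip_def negate_def)
  then show ?thesis
    by (auto simp: fun_eq_iff sphere_point_def negate_def)
qed

section \<open>The source as a closed set of tuples, and equivariant extension from it\<close>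

definition frames :: "nat \<Rightarrow> nat \<Rightarrow> (nat \<Rightarrow> nat \<Rightarrow> real) set"
  where "frames k d = {w. (\<forall>a>d. w 0 a = 0) \<and> (\<Sum>a\<le>d. (w 0 a)\<^sup>2) = 1 \<and>
    (\<forall>i\<in>{1..k}. \<forall>a\<ge>d. w i a = 0) \<and>
    (\<forall>i\<in>{1..k}. \<forall>j\<in>{1..k}. (\<Sum>m<d. w i m * w j m) = (if i = j then 1 else 0))}"

text \<open>In \<open>frames\<close> index \<open>0\<close> holds the sphere point, and vectors
  beyond \<open>k\<close> are unrestricted; they are dropped here.\<close>

definition split_frame :: "nat \<Rightarrow> (nat \<Rightarrow> nat \<Rightarrow> real) \<Rightarrow> (nat \<Rightarrow> real) \<times> (nat \<Rightarrow> nat \<Rightarrow> real)"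
  where "split_frame k w = (w 0, restrict w {1..k})"

lemma split_frame_in_topspace: "split_frame k w \<in> topspace (sphere_Stiefel k d) \<longleftrightarrow> w \<in> frames k d"
  by (auto simp: split_frame_def sphere_Stiefel_def Stiefel_def nsphere_def frames_def
      topspace_Euclidean_space Suc_le_eq)

lemma continuous_on_apply2: "continuous_on S (\<lambda>w :: nat \<Rightarrow> nat \<Rightarrow> real. w i a)"
  by (rule continuous_on_product_then_coordinatewise[OF continuous_on_product_then_coordinatewise])
    (rule continuous_on_id)

lemma closed_frames: "closed (frames k d)"
proof -
  have "frames k d = (\<Inter>a\<in>{d<..}. {w. w 0 a = 0}) \<inter> {w. (\<Sum>a\<le>d. (w 0 a)\<^sup>2) = 1} \<inter>
    (\<Inter>i\<in>{1..k}. \<Inter>a\<in>{d..}. {w. w i a = 0}) \<inter>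
    (\<Inter>i\<in>{1..k}. \<Inter>j\<in>{1..k}. {w. (\<Sum>m<d. w i m * w j m) = (if i = j then 1 else 0)})"
    by (auto simp: frames_def)
  moreover have "closed \<dots>"
    by (intro closed_Int closed_INT ballI closed_Collect_eq continuous_on_const continuous_on_sum
        continuous_on_power continuous_on_mult continuous_on_apply2)
  ultimately show ?thesis by simp
qed

lemma continuous_map_split_frame:
  "continuous_map (top_of_set (frames k d)) (sphere_Stiefel k d) (split_frame k)"
proof -
  have "continuous_map (top_of_set (frames k d)) (powertop_real UNIV) (\<lambda>w. w i)" for i
    by (simp add: continuous_map_componentwise_UNIV continuous_on_apply2)
  then have "continuous_map (top_of_set (frames k d)) (nsphere d) (\<lambda>w. w 0)"
    and "continuous_map (top_of_set (frames k d)) (Stiefel k d) (\<lambda>w. restrict w {1..k})"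
    unfolding nsphere_def Stiefel_def Euclidean_space_def
    by (auto simp: continuous_map_in_subtopology continuous_map_componentwise frames_def Suc_le_eq)
  then show ?thesis
    unfolding sphere_Stiefel_def split_frame_def by (simp add: continuous_map_pairedI)
qed

lemma negate_negate: "negate B (negate {b} w) = negate (if b \<in> B then B - {b} else insert b B) w"
  by (cases "b \<in> B") (intro ext; simp add: negate_def)+

text \<open>Tietze's theorem extends the component from the closed set \<open>frames\<close>, and
  averaging against the character of \<open>i\<close> makes the extension equivariant. The average
  is not divided by the group order \<open>2 ^ Suc k\<close>, which leaves its zeros
  unchanged.\<close>

lemma equivariant_extension:
  assumes cont: "continuous_map (sphere_Stiefel k d) (target_space k d) f"
    and equi: "sign_equivariant k d f" and i: "i \<le> k"
  shows "\<exists>F. continuous_on UNIV F \<and> (\<forall>w\<in>frames k d. F w = 2 ^ Suc k * f (split_frame k w) i a) \<and>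
    (\<forall>b w. b \<le> k \<longrightarrow> F (negate {b} w) = (if b = i then - F w else F w))"
proof -
  let ?h = "\<lambda>w. f (split_frame k w) i a"
  have "continuous_map (top_of_set (frames k d)) (target_space k d) (\<lambda>w. f (split_frame k w))"
    using continuous_map_compose[OF continuous_map_split_frame cont] by (simp add: comp_def)
  then have "continuous_map (top_of_set (frames k d)) (powertop_real UNIV) (\<lambda>w. f (split_frame k w) i)"
    using i unfolding target_space_def Euclidean_space_def
    by (simp add: continuous_map_componentwise continuous_map_in_subtopology)
  then have "continuous_on (frames k d) ?h"
    by (simp add: continuous_map_componentwise_UNIV)
  then obtain E where E: "continuous_on UNIV E" "\<And>w. w \<in> frames k d \<Longrightarrow> E w = ?h w"
    by (rule Tietze_unbounded[where U = UNIV]) (auto simp: closed_frames)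
  have neg: "negate B w \<in> frames k d \<and> ?h (negate B w) = (if i \<in> B then - ?h w else ?h w)"
    if w: "w \<in> frames k d" for B w
  proof
    show "negate B w \<in> frames k d"
    proof -
      have "negate B w i a = 0 \<longleftrightarrow> w i a = 0" "(negate B w i a)\<^sup>2 = (w i a)\<^sup>2" for i a
        by (simp_all add: negate_def)
      moreover have "(\<Sum>m<d. negate B w i m * negate B w j m) =
          (if i \<in> B then - 1 else 1) * (if j \<in> B then - 1 else 1) * (\<Sum>m<d. w i m * w j m)" for i j
        by (cases "i \<in> B"; cases "j \<in> B") (simp_all add: negate_def sum_negf)
      ultimately show ?thesis
        using w by (simp add: frames_def)
    qed
    \<comment> \<open>The group element that is \<open>-1\<close> exactly on
      \<open>B\<close>.\<close>
    define l where "l = (\<lambda>j\<in>{0..k}. if j \<in> B then - 1 else 1 :: real)"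
    have "l \<in> sign_group k" by (auto simp: l_def sign_group_def)
    moreover have "split_frame k w \<in> topspace (sphere_Stiefel k d)"
      using w by (simp add: split_frame_in_topspace)
    ultimately have "f (source_action k l (split_frame k w)) = target_action k l (f (split_frame k w))"
      by (rule equi[unfolded sign_equivariant_def, rule_format])
    moreover have "source_action k l (split_frame k w) = split_frame k (negate B w)"
      by (auto simp: source_action_def split_frame_def scale_tuple_def l_def negate_def fun_eq_iff)
    ultimately show "?h (negate B w) = (if i \<in> B then - ?h w else ?h w)"
      using i by (simp add: target_action_def scale_tuple_def l_def)
  qed
  define F where "F w = (\<Sum>B\<in>Pow {0..k}. (if i \<in> B then - 1 else 1) * E (negate B w))" for w
  have "continuous_on UNIV (\<lambda>w. E (negate B w))" for B
  proof -
    have "continuous_on UNIV (\<lambda>w. negate B w i a)" for i a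
      by (cases "i \<in> B") (simp_all add: negate_def continuous_on_minus continuous_on_apply2)
    then have "continuous_on UNIV (negate B)"
      by (intro continuous_on_coordinatewise_then_product)
    then show ?thesis
      by (rule continuous_on_compose2[OF E(1)]) simp
  qed
  then have "continuous_on UNIV F"
    unfolding F_def by (intro continuous_intros)
  moreover have "F w = 2 ^ Suc k * ?h w" if w: "w \<in> frames k d" for w
  proof -
    have "F w = (\<Sum>B\<in>Pow {0..k}. ?h w)"
      unfolding F_def by (intro sum.cong refl) (use neg[OF w] in \<open>auto simp: E(2)\<close>)
    then show ?thesis by (simp add: card_Pow)
  qed
  moreover have "F (negate {b} w) = (if b = i then - F w else F w)" if b: "b \<le> k" for b w
  proof -
    let ?T = "\<lambda>B. if b \<in> B then B - {b} else insert b B"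
    have "F (negate {b} w) =
        (\<Sum>B\<in>Pow {0..k}. (if b = i then - 1 else 1) * ((if i \<in> B then - 1 else 1) * E (negate B w)))"
      unfolding F_def negate_negate
      by (rule sum.reindex_bij_witness[of _ ?T ?T]) (use b in auto)
    then show ?thesis
      by (simp add: F_def sum_negf)
  qed
  ultimately show ?thesis by blast
qed

theorem theorem3p4:
  fixes k d :: nat
    and f :: "(nat \<Rightarrow> real) \<times> (nat \<Rightarrow> nat \<Rightarrow> real) \<Rightarrow> (nat \<Rightarrow> nat \<Rightarrow> real)"
  assumes "0 < k" and "0 < d" and "k \<le> d"
    and "continuous_map (sphere_Stiefel k d) (target_space k d) f"
    and "sign_equivariant k d f"
  shows "\<exists>p\<in>topspace (sphere_Stiefel k d). \<forall>i\<in>{0..k}. f p i = (\<lambda>m. 0)"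
proof -
  have "\<forall>i a. \<exists>F. i \<le> k \<longrightarrow> continuous_on UNIV F \<and>
      (\<forall>w\<in>frames k d. F w = 2 ^ Suc k * f (split_frame k w) i a) \<and>
      (\<forall>b w. b \<le> k \<longrightarrow> F (negate {b} w) = (if b = i then - F w else F w))"
    using equivariant_extension[OF assms(4,5)] by blast
  then obtain F where F: "\<forall>i a. i \<le> k \<longrightarrow> continuous_on UNIV (F i a) \<and>
      (\<forall>w\<in>frames k d. F i a w = 2 ^ Suc k * f (split_frame k w) i a) \<and>
      (\<forall>b w. b \<le> k \<longrightarrow> F i a (negate {b} w) = (if b = i then - F i a w else F i a w))"
    by metis
  define g where "g = (\<lambda>(i, a) y. if a < d - i then F i a (sphere_point d y)
    else \<Sum>m<d. sphere_point d y i m * sphere_point d y (d - a) m)"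
  \<comment> \<open>An inner product changes sign with \<open>i\<close> and with
    \<open>d - a\<close>; on the cells concerned \<open>d - a < i\<close>, the order of blocks that
    \<open>cube_common_zero\<close> asks for.\<close>
  define R where "R = (\<lambda>(i, a). if a < d - i then {} else {d - a})"
  have "\<exists>y. \<forall>c\<in>cells k d. g c y = 0"
  proof (rule cube_common_zero)
    show "finite (cells k d)"
      by (rule finite_subset[of _ "{..k} \<times> {..<d}"]) (auto simp: cells_def)
    show "R c \<subseteq> {..<fst c}" if "c \<in> cells k d" for c
      using that \<open>k \<le> d\<close> by (auto simp: cells_def R_def split: if_splits)
    show "continuous_on {y. \<forall>c. \<bar>y c\<bar> \<le> 1} (g c)" if c: "c \<in> cells k d" for c
    proof -
      obtain i a where [simp]: "c = (i, a)" and "i \<le> k" using c by (auto simp: cells_def)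
      then have "continuous_on UNIV (F i a)" using F by blast
      moreover have "continuous_on S (sphere_point d)" for S
        by (intro continuous_on_coordinatewise_then_product continuous_on_sphere_point)
      ultimately have "continuous_on S (\<lambda>y. F i a (sphere_point d y))" for S
        using continuous_on_compose2 by blast
      then show ?thesis
        by (cases "a < d - i") (auto simp: g_def intro!: continuous_intros continuous_on_sphere_point)
    qed
    show "g c (flip fst b y) = (if b \<in> insert (fst c) (R c) then - g c y else g c y)"
      if c: "c \<in> cells k d" and rim: "on_rim (cells k d) fst 1 b y" for c b y
    proof -
      obtain i a where [simp]: "c = (i, a)" and ia: "i \<le> k" "a < d" "a \<noteq> d - i"
        using c by (auto simp: cells_def)
      have "b \<le> k" using rim by (auto simp: on_rim_def cells_def)
      then have *: "F i a (negate {b} w) = (if b = i then - F i a w else F i a w)" for w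
        using F ia by blast
      have "d - a \<noteq> i" using ia \<open>k \<le> d\<close> by auto
      show ?thesis
      proof (cases "a < d - i")
        case True
        then show ?thesis by (simp add: g_def R_def sphere_point_flip[OF rim] *)
      next
        case False
        then have g: "g c z = (\<Sum>m<d. sphere_point d z i m * sphere_point d z (d - a) m)" for z
          by (simp add: g_def)
        show ?thesis
          unfolding g sphere_point_flip[OF rim] using False \<open>d - a \<noteq> i\<close>
          by (auto simp: R_def negate_def sum_negf)
      qed
    qed
  qed
  then obtain y where y: "\<And>c. c \<in> cells k d \<Longrightarrow> g c y = 0" by blast
  let ?w = "sphere_point d y"
  have norm1: "(\<Sum>m<d. ?w i m * ?w i m) = 1" if "i \<in> {1..k}" for i
    using sphere_point_norm[of d y i] that \<open>0 < d\<close>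
    by (simp add: sphere_point_eq_0 power2_eq_square flip: lessThan_Suc_atMost)
  have orth: "(\<Sum>m<d. ?w j m * ?w i m) = 0" if "i \<in> {1..k}" "j \<in> {1..k}" "i < j" for i j
  proof -
    \<comment> \<open>The partner index of the cell \<open>(j, a)\<close> is \<open>d - a\<close>,
      which is \<open>i\<close> for \<open>a = d - i\<close>.\<close>
    have "(j, d - i) \<in> cells k d" using that \<open>k \<le> d\<close> by (auto simp: cells_def)
    then have "g (j, d - i) y = 0" by (rule y)
    moreover have "\<not> d - i < d - j" "d - (d - i) = i" using that \<open>k \<le> d\<close> by auto
    ultimately show ?thesis by (simp add: g_def)
  qed
  have "(\<Sum>m<d. ?w i m * ?w j m) = (if i = j then 1 else 0)" if "i \<in> {1..k}" "j \<in> {1..k}" for i j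
    using norm1 orth[OF that] orth[OF that(2,1)] that
    by (cases i j rule: linorder_cases) (auto simp: mult.commute)
  then have w: "?w \<in> frames k d"
    using sphere_point_norm[of d y 0] \<open>0 < d\<close> by (auto simp: frames_def sphere_point_eq_0)
  then have p: "split_frame k ?w \<in> topspace (sphere_Stiefel k d)"
    by (simp add: split_frame_in_topspace)
  have "f (split_frame k ?w) i a = 0" if i: "i \<in> {0..k}" for i a
  proof (cases "a < d - i")
    case True
    then have "(i, a) \<in> cells k d" using i by (auto simp: cells_def)
    from y[OF this] show ?thesis using True F w i by (simp add: g_def)
  next
    case False
    \<comment> \<open>The remaining coordinates vanish because the \<open>i\<close>-th factor of the
      target is \<open>Euclidean_space (d - i)\<close>.\<close>
    have "f (split_frame k ?w) \<in> topspace (target_space k d)"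
      using continuous_map_image_subset_topspace[OF assms(4)] p by blast
    then show ?thesis
      using False i by (auto simp: target_space_def topspace_Euclidean_space PiE_iff)
  qed
  then show ?thesis using p by (intro bexI[of _ "split_frame k ?w"]) auto
qed

end
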